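(* For all $s>0$, the initial datum $(u_0,u_1)$ is almost surely not in $H^s(S^3)\times H^{s-1}(S^3)$.
   Context: $(e_{n,k})_{n\ge1,1\le k\le n^2}$ is a Hilbert basis of $L^2(S^3)$ with $(1-\Delta_{S^3})e_{n,k}=n^2e_{n,k}$ ($S^3$ the unit 3-sphere, $\Delta_{S^3}$ its Laplace-Beltrami operator), and $\|\sum c_{n,k}e_{n,k}\|_{H^s}^2=\sum n^{2s}|c_{n,k}|^2$. $(u_0^{n,k})$, $(u_1^{n,k})$ are real sequences with $\sum_{n,k}(u_0^{n,k})^2<\infty$ and $\sum_{n,k}n^{-2}(u_1^{n,k})^2<\infty$, and such that for every $s>0$ at least one of the series $\sum_{n,k}n^{2s}(u_0^{n,k})^2$ and $\sum_{n,k}n^{2(s-1)}(u_1^{n,k})^2$ diverges. The $a_{n,k}$, $b_{n,k}$ are independent Gaussian random variables of law $\mathcal N(0,1)$, and $u_0=\sum u_0^{n,k}a_{n,k}e_{n,k}$, $u_1=\sum u_1^{n,k}b_{n,k}e_{n,k}$ (a random variable with values in $L^2(S^3)\times H^{-1}(S^3)$). *)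

theory Defs
  imports "HOL-Probability.Probability"
begin

section \<open>The unit 3-sphere\<close>

abbreviation S3 :: "(real ^ 4) set" where
  "S3 \<equiv> sphere 0 1"

text \<open>
  Surface measure as a cone measure: a Borel set \<open>A\<close> of the sphere gets 4 times (the dimension of
  the ambient space) the volume of the cone \<open>{t x | 0 < t < 1, x \<in> A}\<close>.
  Recall that \<open>sgn x = x / |x|\<close>.
\<close>
definition S3_measure :: "(real ^ 4) measure" where
  "S3_measure =
     distr (scale_measure 4 (restrict_space lborel (ball 0 1 - {0}))) (restrict_space borel S3) sgn"

definition dir_deriv :: "real ^ 4 \<Rightarrow> (real ^ 4 \<Rightarrow> complex) \<Rightarrow> real ^ 4 \<Rightarrow> complex" where
  "dir_deriv b F = (\<lambda>x. frechet_derivative F (at x) b)"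

definition dir_derivs :: "(real ^ 4) list \<Rightarrow> (real ^ 4 \<Rightarrow> complex) \<Rightarrow> real ^ 4 \<Rightarrow> complex" where
  "dir_derivs bs F = foldr dir_deriv bs F"

text \<open>
  Functions on the sphere are represented by functions on the ambient space, of which only the
  values on the sphere matter. They are differentiated through their extension to
  \<open>- {0}\<close> that is constant along rays, \<open>F x = f (x / |x|)\<close>: the function \<open>f\<close> is smooth on the sphere
  iff \<open>F\<close> is smooth on \<open>- {0}\<close>, and the Laplace-Beltrami operator applied to \<open>f\<close> is the restriction
  to the sphere of the Euclidean Laplacian of \<open>F\<close>.
\<close>
definition S3_smooth :: "(real ^ 4 \<Rightarrow> complex) \<Rightarrow> bool" where
  "S3_smooth f \<longleftrightarrow>
     (\<forall>bs. set bs \<subseteq> Basis \<longrightarrow> dir_derivs bs (\<lambda>x. f (sgn x)) differentiable_on (- {0}))"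

definition S3_laplacian :: "(real ^ 4 \<Rightarrow> complex) \<Rightarrow> real ^ 4 \<Rightarrow> complex" where
  "S3_laplacian f x = (\<Sum>b\<in>Basis. dir_derivs [b, b] (\<lambda>y. f (sgn y)) x)"


section \<open>Square integrable functions and Hilbert bases\<close>

definition square_integrable :: "'a measure \<Rightarrow> ('a \<Rightarrow> complex) \<Rightarrow> bool" where
  "square_integrable M f \<longleftrightarrow> f \<in> borel_measurable M \<and> integrable M (\<lambda>x. (cmod (f x))\<^sup>2)"

definition L2_norm :: "'a measure \<Rightarrow> ('a \<Rightarrow> complex) \<Rightarrow> real" where
  "L2_norm M f = sqrt (LINT x|M. (cmod (f x))\<^sup>2)"

definition L2_hilbert_basis :: "'a measure \<Rightarrow> 'i set \<Rightarrow> ('i \<Rightarrow> 'a \<Rightarrow> complex) \<Rightarrow> bool" where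
  "L2_hilbert_basis M I e \<longleftrightarrow>
     (\<forall>i\<in>I. square_integrable M (e i)) \<and>
     (\<forall>i\<in>I. \<forall>j\<in>I. (LINT x|M. e i x * cnj (e j x)) = (if i = j then 1 else 0)) \<and>
     (\<forall>f. square_integrable M f \<longrightarrow>
        (\<forall>\<epsilon>>0. \<exists>F c. finite F \<and> F \<subseteq> I \<and> L2_norm M (\<lambda>x. f x - (\<Sum>i\<in>F. c i * e i x)) < \<epsilon>))"


section \<open>Distributions and Sobolev spaces on the sphere\<close>

text \<open>
  Complex linear functionals on the smooth functions, continuous for the usual topology given by
  the suprema over the sphere of finitely many derivatives. The values of \<open>T\<close> at non-smooth
  functions are irrelevant; continuity forces \<open>T \<phi>\<close> to depend only on \<open>\<phi>\<close> restricted to the sphere.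
\<close>
definition S3_distribution :: "((real ^ 4 \<Rightarrow> complex) \<Rightarrow> complex) \<Rightarrow> bool" where
  "S3_distribution T \<longleftrightarrow>
     (\<forall>\<phi> \<psi> c. S3_smooth \<phi> \<longrightarrow> S3_smooth \<psi> \<longrightarrow> T (\<lambda>x. c * \<phi> x + \<psi> x) = c * T \<phi> + T \<psi>) \<and>
     (\<exists>C m. \<forall>\<phi> B. S3_smooth \<phi> \<longrightarrow>
        (\<forall>bs. set bs \<subseteq> Basis \<and> length bs \<le> m \<longrightarrow>
           (\<forall>x\<in>S3. cmod (dir_derivs bs (\<lambda>y. \<phi> (sgn y)) x) \<le> B)) \<longrightarrow>
        cmod (T \<phi>) \<le> C * B)"

definition dist_of :: "(real ^ 4 \<Rightarrow> complex) \<Rightarrow> (real ^ 4 \<Rightarrow> complex) \<Rightarrow> complex" where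
  "dist_of f = (\<lambda>\<phi>. LINT x|S3_measure. f x * \<phi> x)"

definition basis_index :: "(nat \<times> nat) set" where
  "basis_index = (SIGMA n:{1..}. {1..n\<^sup>2})"

text \<open>
  The coefficient of \<open>T\<close> on \<open>e n k\<close>. The pairing of distributions with test functions is bilinear,
  whence the conjugate: for \<open>T = dist_of f\<close> this is the inner product of \<open>f\<close> with \<open>e n k\<close>.
\<close>
definition dist_coeff ::
  "(nat \<Rightarrow> nat \<Rightarrow> real ^ 4 \<Rightarrow> complex) \<Rightarrow> ((real ^ 4 \<Rightarrow> complex) \<Rightarrow> complex) \<Rightarrow> nat \<Rightarrow> nat \<Rightarrow> complex"
where
  "dist_coeff e T n k = T (\<lambda>x. cnj (e n k x))"

definition sobolev ::
  "(nat \<Rightarrow> nat \<Rightarrow> real ^ 4 \<Rightarrow> complex) \<Rightarrow> real \<Rightarrow> ((real ^ 4 \<Rightarrow> complex) \<Rightarrow> complex) set"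
where
  "sobolev e s = {T. S3_distribution T \<and>
     (\<lambda>(n, k). real n powr (2 * s) * (cmod (dist_coeff e T n k))\<^sup>2) summable_on basis_index}"

definition sobolev_norm ::
  "(nat \<Rightarrow> nat \<Rightarrow> real ^ 4 \<Rightarrow> complex) \<Rightarrow> real \<Rightarrow> ((real ^ 4 \<Rightarrow> complex) \<Rightarrow> complex) \<Rightarrow> real"
where
  "sobolev_norm e s T =
     sqrt (\<Sum>\<^sub>\<infinity>(n, k)\<in>basis_index. real n powr (2 * s) * (cmod (dist_coeff e T n k))\<^sup>2)"


section \<open>Sums of series in the basis\<close>

definition partial_series ::
  "(nat \<Rightarrow> nat \<Rightarrow> real ^ 4 \<Rightarrow> complex) \<Rightarrow> (nat \<Rightarrow> nat \<Rightarrow> real) \<Rightarrow> nat \<Rightarrow> real ^ 4 \<Rightarrow> complex"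
where
  "partial_series e c N x = (\<Sum>n=1..N. \<Sum>k=1..n\<^sup>2. complex_of_real (c n k) * e n k x)"

definition sums_in_L2 ::
  "(nat \<Rightarrow> nat \<Rightarrow> real ^ 4 \<Rightarrow> complex) \<Rightarrow> (nat \<Rightarrow> nat \<Rightarrow> real) \<Rightarrow> (real ^ 4 \<Rightarrow> complex) \<Rightarrow> bool"
where
  "sums_in_L2 e c f \<longleftrightarrow> square_integrable S3_measure f \<and>
     (\<lambda>N. L2_norm S3_measure (\<lambda>x. f x - partial_series e c N x)) \<longlonglongrightarrow> 0"

definition sums_in_sobolev ::
  "(nat \<Rightarrow> nat \<Rightarrow> real ^ 4 \<Rightarrow> complex) \<Rightarrow> real \<Rightarrow> (nat \<Rightarrow> nat \<Rightarrow> real) \<Rightarrow>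
   ((real ^ 4 \<Rightarrow> complex) \<Rightarrow> complex) \<Rightarrow> bool"
where
  "sums_in_sobolev e s c T \<longleftrightarrow> T \<in> sobolev e s \<and>
     (\<lambda>N. sobolev_norm e s (\<lambda>\<phi>. T \<phi> - dist_of (partial_series e c N) \<phi>)) \<longlonglongrightarrow> 0"

end

theory Submission
  imports Defs "HOL-Real_Asymp.Real_Asymp"
begin

text \<open>
  Both series determine the coefficients of the initial datum, so membership in the Sobolev space
  means that a series of weighted squares of independent standard normal variables converges, for
  weights \<open>w i \<ge> 0\<close> whose sum diverges for at least one of the two components. Such a series
  diverges almost surely: its Laplace transform over a finite index set \<open>F\<close> is the product of the
  numbers \<open>(1 + 2 * w i) powr (-1/2)\<close>, hence at most \<open>(2 * sum w F) powr (-1/2)\<close>, which tends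
  to \<open>0\<close>, so by Markov's inequality the partial sums stay below a given bound with probability 0.
\<close>

section \<open>Weighted squares of independent standard normal variables\<close>

text \<open>The factor \<open>exp (- (t * x\<^sup>2))\<close> only changes the variance: the
  integrand is a constant multiple of another centred normal density, whose integral is 1, and the
  constant is the value sought.\<close>

lemma integral_std_normal_exp_neg_square:
  fixes t :: real
  assumes "t \<ge> 0"
  shows "(LINT x|lborel. std_normal_density x * exp (- (t * x\<^sup>2))) = 1 / sqrt (1 + 2 * t)"
proof -
  \<comment> \<open>Chosen so that the total exponent \<open>- x\<^sup>2 / 2 - t * x\<^sup>2\<close>
    becomes \<open>- x\<^sup>2 / (2 * \<sigma>\<^sup>2)\<close>.\<close>
  define \<sigma> where "\<sigma> = 1 / sqrt (1 + 2 * t)"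
  have pos: "\<sigma> > 0" and sq: "\<sigma>\<^sup>2 = 1 / (1 + 2 * t)"
    using assms by (auto simp: \<sigma>_def power_divide)
  have ex: "- x\<^sup>2 / 2 + - (t * x\<^sup>2) = - x\<^sup>2 / (2 * \<sigma>\<^sup>2)" for x :: real
    using assms by (simp add: sq field_simps)
  have "std_normal_density x * exp (- (t * x\<^sup>2)) = \<sigma> * normal_density 0 \<sigma> x" for x
  proof -
    have "std_normal_density x * exp (- (t * x\<^sup>2)) = 1 / sqrt (2 * pi) * exp (- x\<^sup>2 / (2 * \<sigma>\<^sup>2))"
      using exp_add[of "- x\<^sup>2 / 2" "- (t * x\<^sup>2)"] unfolding ex by (simp add: std_normal_density_def)
    then show ?thesis
      using pos by (simp add: normal_density_def real_sqrt_mult)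
  qed
  then show ?thesis
    using pos by (simp add: \<sigma>_def)
qed

lemma (in prob_space) expectation_exp_neg_square_normal:
  assumes "distributed M lborel X std_normal_density" "t \<ge> 0"
  shows "expectation (\<lambda>\<omega>. exp (- (t * (X \<omega>)\<^sup>2))) = 1 / sqrt (1 + 2 * t)"
  using distributed_integral[OF assms(1), of "\<lambda>x. exp (- (t * x\<^sup>2))"] assms(2)
  by (simp add: integral_std_normal_exp_neg_square)

lemma (in prob_space) expectation_exp_neg_weighted_squares_le:
  fixes X :: "'i \<Rightarrow> 'a \<Rightarrow> real"
  assumes indep: "indep_vars (\<lambda>_. borel) X F" and fin: "finite F"
    and normal: "\<And>i. i \<in> F \<Longrightarrow> distributed M lborel (X i) std_normal_density"
    and w: "\<And>i. i \<in> F \<Longrightarrow> w i \<ge> 0" and pos: "sum w F > 0"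
  shows "expectation (\<lambda>\<omega>. exp (- (\<Sum>i\<in>F. w i * (X i \<omega>)\<^sup>2))) \<le> 1 / sqrt (2 * sum w F)"
proof -
  have ind: "indep_vars (\<lambda>_. borel) (\<lambda>i \<omega>. exp (- (w i * (X i \<omega>)\<^sup>2))) F"
    using indep_vars_compose2[OF indep, of "\<lambda>i x. exp (- (w i * x\<^sup>2))" "\<lambda>_. borel"] by simp
  have meas: "X i \<in> borel_measurable M" if "i \<in> F" for i
    using indep that by (auto simp: indep_vars_def)
  have int: "integrable M (\<lambda>\<omega>. exp (- (w i * (X i \<omega>)\<^sup>2)))" if "i \<in> F" for i
    using meas[OF that] w[OF that]
    by (intro integrable_const_bound[where B = 1]) auto
  have "expectation (\<lambda>\<omega>. exp (- (\<Sum>i\<in>F. w i * (X i \<omega>)\<^sup>2)))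
      = expectation (\<lambda>\<omega>. \<Prod>i\<in>F. exp (- (w i * (X i \<omega>)\<^sup>2)))"
    by (simp add: exp_sum[OF fin] sum_negf[symmetric])
  also have "\<dots> = (\<Prod>i\<in>F. 1 / sqrt (1 + 2 * w i))"
    using indep_vars_lebesgue_integral[OF fin ind int] normal w
    by (simp add: expectation_exp_neg_square_normal)
  also have "\<dots> = 1 / sqrt (\<Prod>i\<in>F. 1 + 2 * w i)"
    using fin by (induction F rule: finite_induct) (auto simp: real_sqrt_mult)
  also have "\<dots> \<le> 1 / sqrt (2 * sum w F)"
  proof -
    \<comment> \<open>Expanding the product gives nonnegative terms, among them all the linear ones
      \<open>2 * w i\<close>.\<close>
    have "2 * sum w F \<le> (\<Prod>i\<in>F. 1 + 2 * w i)"
      using sum_le_prod[of F "\<lambda>i. 2 * w i"] w by (simp add: sum_distrib_left)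
    then show ?thesis
      using pos by (intro divide_left_mono mult_pos_pos) auto
  qed
  finally show ?thesis .
qed

theorem (in prob_space) AE_not_summable_weighted_normal_squares:
  fixes X :: "'i \<Rightarrow> 'a \<Rightarrow> real"
  assumes indep: "indep_vars (\<lambda>_. borel) X I"
    and normal: "\<And>i. i \<in> I \<Longrightarrow> distributed M lborel (X i) std_normal_density"
    and w: "\<And>i. i \<in> I \<Longrightarrow> w i \<ge> 0" and div: "\<not> w summable_on I"
  shows "AE \<omega> in M. \<not> (\<lambda>i. w i * (X i \<omega>)\<^sup>2) summable_on I"
proof -
  \<comment> \<open>For nonnegative weights, bounded finite sums would already give
    summability.\<close>
  have "\<exists>F. finite F \<and> F \<subseteq> I \<and> sum w F > real m" for m
  proof (rule ccontr)
    assume "\<not> ?thesis"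
    then have "bdd_above (sum w ` {F. F \<subseteq> I \<and> finite F})"
      by (intro bdd_aboveI2[where M = "real m"]) (auto simp: not_less)
    then show False
      using div nonneg_bdd_above_summable_on[of I w] w by blast
  qed
  then obtain F where F: "\<And>m. finite (F m)" "\<And>m. F m \<subseteq> I" "\<And>m. sum w (F m) > real m"
    by metis
  define S where "S m \<omega> = (\<Sum>i\<in>F m. w i * (X i \<omega>)\<^sup>2)" for m \<omega>
  have meas: "X i \<in> borel_measurable M" if "i \<in> I" for i
    using indep that by (auto simp: indep_vars_def)
  have S_meas[measurable]: "S m \<in> borel_measurable M" for m
    unfolding S_def using F(2) meas by (intro borel_measurable_sum) (auto simp: subset_iff)
  have S_nonneg: "S m \<omega> \<ge> 0" for m \<omega>
    unfolding S_def using F(2) w by (intro sum_nonneg) (auto simp: subset_iff)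
  have "AE \<omega> in M. \<exists>m. S m \<omega> > K" for K
  proof -
    \<comment> \<open>The sets \<open>F m\<close> need not be nested: \<open>?A\<close> lies in each
      event \<open>S m \<omega> \<le> K\<close>, so every single \<open>m\<close> bounds its
      probability.\<close>
    let ?A = "{\<omega> \<in> space M. \<forall>m. S m \<omega> \<le> K}"
    \<comment> \<open>At \<open>m = 0\<close> the right-hand side would be \<open>0\<close> by the
      convention on division by zero, hence the restriction to \<open>m > 0\<close>.\<close>
    have bound: "prob ?A \<le> exp K / sqrt (2 * real m)" if "m > 0" for m
    proof -
      have "prob ?A \<le> prob {\<omega> \<in> space M. exp (- S m \<omega>) \<ge> exp (- K)}"
        by (intro finite_measure_mono) auto
      also have "\<dots> \<le> expectation (\<lambda>\<omega>. exp (- S m \<omega>)) / exp (- K)"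
        using S_nonneg by (intro integral_Markov_inequality_measure[where A = "{}"]
            integrable_const_bound[where B = 1]) auto
      also have "\<dots> \<le> 1 / sqrt (2 * sum w (F m)) / exp (- K)"
        unfolding S_def using F w normal indep_vars_subset[OF indep F(2)]
        by (intro divide_right_mono expectation_exp_neg_weighted_squares_le)
          (auto simp: subset_iff intro: le_less_trans[OF of_nat_0_le_iff F(3)])
      also have "\<dots> \<le> 1 / sqrt (2 * real m) / exp (- K)"
        using that F(3)[of m] by (intro divide_right_mono divide_left_mono) auto
      finally show ?thesis
        by (simp add: exp_minus field_simps)
    qed
    have "(\<lambda>m. exp K / sqrt (2 * real m)) \<longlonglongrightarrow> 0"
      by real_asymp
    then have "prob ?A \<le> 0"
      by (rule tendsto_lowerbound) (auto intro!: eventually_mono[OF eventually_gt_at_top[of 0]] bound)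
    then have "prob ?A = 0"
      by (simp add: measure_le_0_iff)
    then show ?thesis
      by (subst AE_iff_measurable[of ?A]) (auto simp: emeasure_eq_measure not_less)
  qed
  \<comment> \<open>Natural bounds suffice, and countably many null sets can be discarded at
    once.\<close>
  then have "AE \<omega> in M. \<forall>K::nat. \<exists>m. S m \<omega> > real K"
    by (simp add: AE_all_countable)
  then show ?thesis
  proof (rule AE_mp, intro AE_I2 impI notI)
    fix \<omega>
    assume unb: "\<forall>K::nat. \<exists>m. S m \<omega> > real K"
      and summ: "(\<lambda>i. w i * (X i \<omega>)\<^sup>2) summable_on I"
    obtain K :: nat where K: "infsum (\<lambda>i. w i * (X i \<omega>)\<^sup>2) I \<le> real K"
      using real_arch_simple by blast
    \<comment> \<open>If the series of nonnegative terms converged, its sum would bound all the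
      finite sums.\<close>
    have "S m \<omega> \<le> real K" for m
      unfolding S_def using finite_sum_le_infsum[OF summ F(1) F(2), of m] w K by fastforce
    with unb show False
      by (meson not_less)
  qed
qed

section \<open>Square integrable functions and a one-vector Bessel inequality\<close>

lemma integrable_mult_cnj:
  assumes "square_integrable M f" "square_integrable M g"
  shows "integrable M (\<lambda>x. f x * cnj (g x))"
proof (rule Bochner_Integration.integrable_bound)
  show "integrable M (\<lambda>x. (cmod (f x))\<^sup>2 + (cmod (g x))\<^sup>2)"
    using assms by (auto simp: square_integrable_def)
  have [measurable]: "cnj \<in> borel_measurable borel"
    by (intro borel_measurable_continuous_onI continuous_intros)
  show "(\<lambda>x. f x * cnj (g x)) \<in> borel_measurable M"
    using assms by (auto simp: square_integrable_def)
  have "a * b \<le> a\<^sup>2 + b\<^sup>2" if "a \<ge> 0" "b \<ge> 0" for a b :: real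
    using sum_squares_bound[of a b] that mult_nonneg_nonneg[of a b] by linarith
  then show "AE x in M. norm (f x * cnj (g x)) \<le> norm ((cmod (f x))\<^sup>2 + (cmod (g x))\<^sup>2)"
    by (simp add: norm_mult)
qed

lemma square_integrable_add:
  assumes "square_integrable M f" "square_integrable M g"
  shows "square_integrable M (\<lambda>x. f x + g x)"
proof -
  have "integrable M (\<lambda>x. (cmod (f x + g x))\<^sup>2)"
  proof (rule Bochner_Integration.integrable_bound)
    show "integrable M (\<lambda>x. 2 * (cmod (f x))\<^sup>2 + 2 * (cmod (g x))\<^sup>2)"
      using assms by (auto simp: square_integrable_def)
    show "(\<lambda>x. (cmod (f x + g x))\<^sup>2) \<in> borel_measurable M"
      using assms by (auto simp: square_integrable_def)
    have "(cmod (a + b))\<^sup>2 \<le> 2 * (cmod a)\<^sup>2 + 2 * (cmod b)\<^sup>2" for a b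
    proof -
      have "(cmod (a + b))\<^sup>2 \<le> (cmod a + cmod b)\<^sup>2"
        by (intro power_mono norm_triangle_ineq) auto
      with sum_squares_bound[of "cmod a" "cmod b"] show ?thesis
        by (simp add: power2_sum)
    qed
    then show "AE x in M. norm ((cmod (f x + g x))\<^sup>2) \<le> norm (2 * (cmod (f x))\<^sup>2 + 2 * (cmod (g x))\<^sup>2)"
      by simp
  qed
  with assms show ?thesis
    by (auto simp: square_integrable_def)
qed

lemma square_integrable_cmult:
  "square_integrable M f \<Longrightarrow> square_integrable M (\<lambda>x. c * f x)"
  by (auto simp: square_integrable_def norm_mult power_mult_distrib)

lemma square_integrable_sum:
  "(\<And>i. i \<in> A \<Longrightarrow> square_integrable M (f i)) \<Longrightarrow> square_integrable M (\<lambda>x. \<Sum>i\<in>A. f i x)"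
proof (induction A rule: infinite_finite_induct)
  case (insert i A)
  then show ?case
    by (simp add: square_integrable_add)
qed (simp_all add: square_integrable_def)

text \<open>With \<open>c\<close> the inner product of \<open>f\<close> and the unit vector
  \<open>g\<close>, the squared norm of \<open>f - c * g\<close> equals that of \<open>f\<close>
  minus \<open>(cmod c)\<^sup>2\<close>, and it is nonnegative. This is what makes coefficients
  continuous under convergence in L2.\<close>

lemma bessel_unit_vector:
  assumes f: "square_integrable M f" and g: "square_integrable M g"
    and unit: "(LINT x|M. g x * cnj (g x)) = 1"
  shows "cmod (LINT x|M. f x * cnj (g x)) \<le> L2_norm M f"
proof -
  define c where "c = (LINT x|M. f x * cnj (g x))"
  have int_fg: "integrable M (\<lambda>x. f x * cnj (g x))"
    by (rule integrable_mult_cnj[OF f g])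
  have int_f: "integrable M (\<lambda>x. (cmod (f x))\<^sup>2)" and int_g: "integrable M (\<lambda>x. (cmod (g x))\<^sup>2)"
    using f g by (auto simp: square_integrable_def)
  \<comment> \<open>The normalisation is given as a complex integral; the expansion below needs it
    as a real one.\<close>
  have norm_g: "(LINT x|M. (cmod (g x))\<^sup>2) = 1"
  proof -
    have "complex_of_real (LINT x|M. (cmod (g x))\<^sup>2) = (LINT x|M. g x * cnj (g x))"
      by (simp only: integral_complex_of_real[symmetric] complex_norm_square)
    then show ?thesis
      using unit by (simp only: of_real_eq_1_iff)
  qed
  have int_Re: "integrable M (\<lambda>x. 2 * Re (cnj c * (f x * cnj (g x))))"
    using int_fg by (intro integrable_mult_right integrable_Re) auto
  have "(LINT x|M. Re (cnj c * (f x * cnj (g x)))) = (cmod c)\<^sup>2"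
    using int_fg by (subst integral_Re) (auto simp: c_def[symmetric] cmod_power2, simp add: power2_eq_square)
  then have Re_eq: "(LINT x|M. 2 * Re (cnj c * (f x * cnj (g x)))) = 2 * (cmod c)\<^sup>2"
    by (simp only: integral_mult_right_zero)
  have "0 \<le> (LINT x|M. (cmod (f x - c * g x))\<^sup>2)"
    by simp
  also have "\<dots> = (LINT x|M. (cmod (f x))\<^sup>2 - 2 * Re (cnj c * (f x * cnj (g x)))
      + (cmod c)\<^sup>2 * (cmod (g x))\<^sup>2)"
    by (intro Bochner_Integration.integral_cong refl)
      (simp add: cmod_power2, simp add: power2_eq_square algebra_simps)
  also have "\<dots> = (LINT x|M. (cmod (f x))\<^sup>2) - (cmod c)\<^sup>2"
    using int_f int_g int_Re Re_eq norm_g by simp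
  finally show ?thesis
    by (simp add: L2_norm_def c_def real_le_rsqrt)
qed

section \<open>Coefficients of convergent series in the basis\<close>

context
  fixes e :: "nat \<Rightarrow> nat \<Rightarrow> real ^ 4 \<Rightarrow> complex"
  assumes basis: "L2_hilbert_basis S3_measure basis_index (\<lambda>(n, k). e n k)"
begin

lemma basis_square_integrable:
  "(n, k) \<in> basis_index \<Longrightarrow> square_integrable S3_measure (e n k)"
  using basis by (fastforce simp: L2_hilbert_basis_def)

lemma basis_orthonormal:
  assumes "(n, k) \<in> basis_index" "(m, l) \<in> basis_index"
  shows "(LINT x|S3_measure. e n k x * cnj (e m l x)) = (if n = m \<and> k = l then 1 else 0)"
proof -
  have "\<forall>i\<in>basis_index. \<forall>j\<in>basis_index.
      (LINT x|S3_measure. (case i of (n, k) \<Rightarrow> e n k) x * cnj ((case j of (n, k) \<Rightarrow> e n k) x))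
        = (if i = j then 1 else 0)"
    using basis unfolding L2_hilbert_basis_def by blast
  from bspec[OF bspec[OF this assms(1)] assms(2)] show ?thesis
    by simp
qed

lemma square_integrable_partial_series: "square_integrable S3_measure (partial_series e c N)"
  unfolding partial_series_def
  by (intro square_integrable_sum square_integrable_cmult basis_square_integrable)
    (auto simp: basis_index_def)

text \<open>By orthonormality only the term with index \<open>(n, k)\<close> survives, and the
  partial sum contains it exactly when \<open>N\<close> has reached \<open>n\<close>.\<close>

lemma dist_coeff_partial_series:
  assumes "(n, k) \<in> basis_index"
  shows "dist_coeff e (dist_of (partial_series e c N)) n k = (if n \<le> N then of_real (c n k) else 0)"
proof -
  have int: "integrable S3_measure (\<lambda>x. e m l x * cnj (e n k x))" if "m \<in> {1..N}" "l \<in> {1..m\<^sup>2}" for m l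
    using assms that by (intro integrable_mult_cnj basis_square_integrable) (auto simp: basis_index_def)
  have "dist_coeff e (dist_of (partial_series e c N)) n k =
      (LINT x|S3_measure. (\<Sum>m=1..N. \<Sum>l=1..m\<^sup>2. of_real (c m l) * (e m l x * cnj (e n k x))))"
    by (simp add: dist_coeff_def dist_of_def partial_series_def sum_distrib_right mult.assoc)
  also have "\<dots> = (\<Sum>m=1..N. LINT x|S3_measure. (\<Sum>l=1..m\<^sup>2. of_real (c m l) * (e m l x * cnj (e n k x))))"
    by (intro Bochner_Integration.integral_sum Bochner_Integration.integrable_sum
        integrable_mult_right int)
  also have "\<dots> = (\<Sum>m=1..N. \<Sum>l=1..m\<^sup>2. LINT x|S3_measure. of_real (c m l) * (e m l x * cnj (e n k x)))"
    by (intro sum.cong refl Bochner_Integration.integral_sum integrable_mult_right int)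
  also have "\<dots> = (\<Sum>m=1..N. \<Sum>l=1..m\<^sup>2. of_real (c m l) * (if m = n \<and> l = k then 1 else 0))"
    using assms by (intro sum.cong refl, subst integral_mult_right_zero, subst basis_orthonormal)
      (auto simp: basis_index_def)
  \<comment> \<open>The condition is split in two so that each sum collapses separately; membership
    in \<open>basis_index\<close> then settles every range condition except
    \<open>n \<le> N\<close>.\<close>
  also have "\<dots> = (\<Sum>m=1..N. if m = n then (\<Sum>l=1..m\<^sup>2. if l = k then of_real (c m l) else 0) else 0)"
    by (intro sum.cong refl) (auto simp: mult_delta_right)
  also have "\<dots> = (if n \<le> N then of_real (c n k) else 0)"
    using assms by (simp add: basis_index_def)
  finally show ?thesis .
qed

text \<open>From \<open>N = n\<close> on, the coefficient of the partial sum no longer changes. Its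
  distance to the coefficient of \<open>f\<close> is thus a constant bounded by remainder norms that
  tend to \<open>0\<close>.\<close>

lemma dist_coeff_sums_in_L2:
  assumes sums: "sums_in_L2 e c f" and nk: "(n, k) \<in> basis_index"
  shows "dist_coeff e (dist_of f) n k = of_real (c n k)"
proof -
  let ?d = "dist_coeff e (dist_of f) n k"
  have f: "square_integrable S3_measure f"
    and lim: "(\<lambda>N. L2_norm S3_measure (\<lambda>x. f x - partial_series e c N x)) \<longlonglongrightarrow> 0"
    using sums by (auto simp: sums_in_L2_def)
  have "cmod (?d - of_real (c n k)) \<le> L2_norm S3_measure (\<lambda>x. f x - partial_series e c N x)"
    if "N \<ge> n" for N
  proof -
    let ?S = "partial_series e c N"
    have "square_integrable S3_measure (\<lambda>x. f x - ?S x)"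
      using square_integrable_add[OF f square_integrable_cmult[OF square_integrable_partial_series, of "-1"]]
      by simp
    then have "cmod (LINT x|S3_measure. (f x - ?S x) * cnj (e n k x))
        \<le> L2_norm S3_measure (\<lambda>x. f x - ?S x)"
      using nk by (intro bessel_unit_vector basis_square_integrable) (auto simp: basis_orthonormal)
    moreover have "(LINT x|S3_measure. (f x - ?S x) * cnj (e n k x))
        = ?d - dist_coeff e (dist_of ?S) n k"
      unfolding dist_coeff_def dist_of_def left_diff_distrib
      by (intro Bochner_Integration.integral_diff integrable_mult_cnj f
          square_integrable_partial_series basis_square_integrable nk)
    ultimately show ?thesis
      using that by (simp add: dist_coeff_partial_series[OF nk])
  qed
  then have "cmod (?d - of_real (c n k)) \<le> 0"
    by (intro tendsto_lowerbound[OF lim]) (auto intro: eventually_mono[OF eventually_ge_at_top[of n]])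
  then show ?thesis
    by simp
qed

text \<open>Same argument as in L2, with the bound now read off the norm itself: one weighted
  squared coefficient is at most the whole sum.\<close>

lemma dist_coeff_sums_in_sobolev:
  assumes sums: "sums_in_sobolev e s c T" and nk: "(n, k) \<in> basis_index"
  shows "dist_coeff e T n k = of_real (c n k)"
proof -
  let ?R = "\<lambda>N \<phi>. T \<phi> - dist_of (partial_series e c N) \<phi>"
  let ?g = "\<lambda>T (n, k). real n powr (2 * s) * (cmod (dist_coeff e T n k))\<^sup>2"
  let ?d = "dist_coeff e T n k - of_real (c n k)"
  have T: "?g T summable_on basis_index" and lim: "(\<lambda>N. sobolev_norm e s (?R N)) \<longlonglongrightarrow> 0"
    using sums by (auto simp: sums_in_sobolev_def sobolev_def)
  have R: "dist_coeff e (?R N) m l = dist_coeff e T m l - (if m \<le> N then of_real (c m l) else 0)"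
    if "(m, l) \<in> basis_index" for N m l
    using dist_coeff_partial_series[OF that, of c N] by (simp add: dist_coeff_def)
  have bound: "sqrt (real n powr (2 * s) * (cmod ?d)\<^sup>2) \<le> sobolev_norm e s (?R N)" if "N \<ge> n" for N
  proof -
    \<comment> \<open>As \<open>infsum\<close> is \<open>0\<close> for a family that is not
      summable, summability for the remainder must come first. Outside the finite set
      \<open>?F\<close> the remainder has the coefficients of \<open>T\<close>, whose family is
      summable.\<close>
    let ?F = "SIGMA m:{1..N}. {1..m\<^sup>2}"
    have "?g T summable_on (basis_index - ?F)"
      by (rule summable_on_subset_banach[OF T]) auto
    then have "?g (?R N) summable_on (basis_index - ?F)"
      by (rule summable_on_cong[THEN iffD1, rotated]) (auto simp: R basis_index_def split: if_splits)
    then have "?g (?R N) summable_on ((basis_index - ?F) \<union> ?F)"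
      by (rule summable_on_Un_disjoint) auto
    moreover have "(basis_index - ?F) \<union> ?F = basis_index"
      by (auto simp: basis_index_def)
    ultimately have "sum (?g (?R N)) {(n, k)} \<le> infsum (?g (?R N)) basis_index"
      using nk by (intro finite_sum_le_infsum) auto
    then show ?thesis
      using that by (simp add: sobolev_norm_def R[OF nk])
  qed
  then have "sqrt (real n powr (2 * s) * (cmod ?d)\<^sup>2) \<le> 0"
    by (intro tendsto_lowerbound[OF lim]) (auto intro: eventually_mono[OF eventually_ge_at_top[of n]])
  \<comment> \<open>Indices start at \<open>n = 1\<close>, so the weight is positive and can be
    cancelled.\<close>
  moreover have "real n powr (2 * s) > 0"
    using nk by (simp add: basis_index_def)
  ultimately show ?thesis
    by (simp add: real_sqrt_mult mult_le_0_iff)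
qed

end

section \<open>Sobolev regularity of the random initial datum\<close>

text \<open>Separates the deterministic weight from the squared random factor, the form to which the
  almost sure divergence applies.\<close>

lemma in_sobolev_imp_summable:
  assumes "T \<in> sobolev e s"
    and "\<And>n k. (n, k) \<in> basis_index \<Longrightarrow> dist_coeff e T n k = of_real (c n k * x n k)"
  shows "(\<lambda>(n, k). real n powr (2 * s) * (c n k)\<^sup>2 * (x n k)\<^sup>2) summable_on basis_index"
proof -
  have "(\<lambda>(n, k). real n powr (2 * s) * (cmod (dist_coeff e T n k))\<^sup>2) summable_on basis_index"
    using assms(1) by (simp add: sobolev_def)
  then show ?thesis
    by (rule summable_on_cong[THEN iffD1, rotated])
      (auto simp: assms(2) norm_mult power_mult_distrib)
qed

theorem proposition3p12:
  fixes e :: "nat \<Rightarrow> nat \<Rightarrow> real ^ 4 \<Rightarrow> complex"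
    and u0c u1c :: "nat \<Rightarrow> nat \<Rightarrow> real"
    and M :: "'w measure"
    and a b :: "nat \<Rightarrow> nat \<Rightarrow> 'w \<Rightarrow> real"
    and u0 :: "'w \<Rightarrow> real ^ 4 \<Rightarrow> complex"
    and u1 :: "'w \<Rightarrow> (real ^ 4 \<Rightarrow> complex) \<Rightarrow> complex"
  assumes basis: "L2_hilbert_basis S3_measure basis_index (\<lambda>(n, k). e n k)"
    and smooth: "\<forall>(n, k)\<in>basis_index. S3_smooth (e n k)"
    and eigen: "\<forall>(n, k)\<in>basis_index. \<forall>x\<in>S3. e n k x - S3_laplacian (e n k) x = (of_nat n)\<^sup>2 * e n k x"
    and u0c_summable: "(\<lambda>(n, k). (u0c n k)\<^sup>2) summable_on basis_index"
    and u1c_summable: "(\<lambda>(n, k). real n powr (-2) * (u1c n k)\<^sup>2) summable_on basis_index"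
    and diverges: "\<forall>s>0.
          \<not> (\<lambda>(n, k). real n powr (2 * s) * (u0c n k)\<^sup>2) summable_on basis_index \<or>
          \<not> (\<lambda>(n, k). real n powr (2 * (s - 1)) * (u1c n k)\<^sup>2) summable_on basis_index"
    and prob: "prob_space M"
    and gauss_a: "\<forall>(n, k)\<in>basis_index. distributed M lborel (a n k) std_normal_density"
    and gauss_b: "\<forall>(n, k)\<in>basis_index. distributed M lborel (b n k) std_normal_density"
    and indep: "prob_space.indep_vars M (\<lambda>_. borel)
          (case_sum (\<lambda>(n, k). a n k) (\<lambda>(n, k). b n k)) (basis_index <+> basis_index)"
    and u0: "AE \<omega> in M. sums_in_L2 e (\<lambda>n k. u0c n k * a n k \<omega>) (u0 \<omega>)"
    and u1: "AE \<omega> in M. sums_in_sobolev e (-1) (\<lambda>n k. u1c n k * b n k \<omega>) (u1 \<omega>)"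
  shows "\<forall>s>0. AE \<omega> in M. (dist_of (u0 \<omega>), u1 \<omega>) \<notin> sobolev e s \<times> sobolev e (s - 1)"
proof (intro allI impI)
  fix s :: real
  assume "s > 0"
  interpret prob_space M
    by (rule prob)
  define X where "X = case_sum (\<lambda>(n, k). a n k) (\<lambda>(n, k). b n k)"
  have X_simps: "X (Inl (n, k)) = a n k" "X (Inr (n, k)) = b n k" for n k
    by (simp_all add: X_def)
  have indep_sub: "indep_vars (\<lambda>_. borel) X (Inl ` basis_index)"
      "indep_vars (\<lambda>_. borel) X (Inr ` basis_index)"
    using indep unfolding X_def[symmetric] by (auto intro: indep_vars_subset)
  have normal: "distributed M lborel (X i) std_normal_density" if "i \<in> basis_index <+> basis_index" for i
    using that gauss_a gauss_b by (fastforce simp: X_simps)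
  \<comment> \<open>Weights of the two Sobolev conditions, on the same disjoint sum of index sets as
    \<open>X\<close>.\<close>
  define w where "w = case_sum (\<lambda>(n, k). real n powr (2 * s) * (u0c n k)\<^sup>2)
      (\<lambda>(n, k). real n powr (2 * (s - 1)) * (u1c n k)\<^sup>2)"
  have w_nonneg: "w i \<ge> 0" for i
    by (auto simp: w_def split: sum.split)
  have w_Inl: "w \<circ> Inl = (\<lambda>(n, k). real n powr (2 * s) * (u0c n k)\<^sup>2)"
    and w_Inr: "w \<circ> Inr = (\<lambda>(n, k). real n powr (2 * (s - 1)) * (u1c n k)\<^sup>2)"
    by (auto simp: w_def)
  \<comment> \<open>Which component has divergent weights depends on \<open>s\<close> alone, not on
    \<open>\<omega>\<close>; failure of that component already keeps the pair out of the product
    space.\<close>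
  consider "\<not> w summable_on Inl ` basis_index" | "\<not> w summable_on Inr ` basis_index"
    using diverges \<open>s > 0\<close> by (auto simp: summable_on_reindex w_Inl w_Inr)
  then show "AE \<omega> in M. (dist_of (u0 \<omega>), u1 \<omega>) \<notin> sobolev e s \<times> sobolev e (s - 1)"
  proof cases
    case 1
    have "AE \<omega> in M. \<not> (\<lambda>i. w i * (X i \<omega>)\<^sup>2) summable_on Inl ` basis_index"
      using normal w_nonneg
      by (intro AE_not_summable_weighted_normal_squares indep_sub 1) auto
    with u0 show ?thesis
    proof eventually_elim
      case (elim \<omega>)
      have "dist_of (u0 \<omega>) \<notin> sobolev e s"
      proof
        assume "dist_of (u0 \<omega>) \<in> sobolev e s"
        from in_sobolev_imp_summable[OF this dist_coeff_sums_in_L2[OF basis elim(1)]] elim(2)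
        show False
          by (simp add: summable_on_reindex o_def w_def X_def case_prod_unfold)
      qed
      then show ?case
        by simp
    qed
  next
    case 2
    have "AE \<omega> in M. \<not> (\<lambda>i. w i * (X i \<omega>)\<^sup>2) summable_on Inr ` basis_index"
      using normal w_nonneg
      by (intro AE_not_summable_weighted_normal_squares indep_sub 2) auto
    with u1 show ?thesis
    proof eventually_elim
      case (elim \<omega>)
      have "u1 \<omega> \<notin> sobolev e (s - 1)"
      proof
        assume "u1 \<omega> \<in> sobolev e (s - 1)"
        \<comment> \<open>The series for \<open>u1\<close> converges in the space of exponent
          \<open>-1\<close>, which fixes its coefficients; membership is then tested at exponent
          \<open>s - 1\<close> with these same coefficients.\<close>
        from in_sobolev_imp_summable[OF this dist_coeff_sums_in_sobolev[OF basis elim(1)]] elim(2)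
        show False
          by (simp add: summable_on_reindex o_def w_def X_def case_prod_unfold)
      qed
      then show ?case
        by simp
    qed
  qed
qed

end
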